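(* Let $H$ be a reproducing kernel Hilbert space with kernel functions $\{k_i\}_{i=1}^m$, $m\ge4$, and $X(H)=\{x_i\}_{i=1}^m$. Suppose that for every four element set of indices $\Lambda\subset\{1,\dots,m\}$ the space $H(\Lambda)$ has the complete Pick property. Then $H\sim DA_1(Y)$ for some $Y\subset\mathbb{CH}^1$ (that is, $H$ is an r-Pick space) if and only if $LF_{ijk}=\delta_{ik}$ for all $1\le i<j<k\le m$.
   Context: A finite dimensional reproducing kernel Hilbert space (RKHS) $H$ is a complex inner product space with a distinguished basis $\{k_i\}_{i=1}^m$ of reproducing kernels, indexed by $X(H)=\{x_i\}_{i=1}^m$; vectors are functions on $X(H)$ via $h(x_i)=\langle h,k_i\rangle$. Write $k_{ij}=\langle k_i,k_j\rangle$. Standing assumption: any two kernels are linearly independent and $k_{ij}\ne0$ for all $i,j$. For a set of indices $\Lambda$, $H(\Lambda)$ is the RKHS that is the subspace spanned by $\{k_i\}_{i\in\Lambda}$. $\delta_{ij}=\left(1-\frac{|k_{ij}|^2}{k_{ii}k_{jj}}\right)^{1/2}$, and $LF_{ijk}\ge0$ with $LF_{ijk}^2=\frac1{\delta_{ij}^2}\left|1-\frac{k_{ji}k_{ik}}{k_{jk}k_{ii}}\right|^2$. Complete Pick property of an RKHS $J$: for $Z\subset X(J)$ let $J_Z$ be the RKHS spanned by $\{k_z\}_{z\in Z}$; a multiplier is an operator of pointwise multiplication by a (matrix-valued) function, with operator norm. $J$ has the complete Pick property if for every $Z\subset X(J)$ every matrix-valued multiplier (of any size) of $J_Z$ of norm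 one extends to a matrix-valued multiplier of $J$ of norm one. Rescaling: $H\sim\widetilde H$ if there are a bijection $\Xi:X(H)\to X(\widetilde H)$ and a nowhere vanishing $\gamma$ on $X(H)$ with $\langle\tilde k_{\Xi(x)},\tilde k_{\Xi(y)}\rangle=\gamma(x)\overline{\gamma(y)}\langle k_x,k_y\rangle$ for all $x,y\in X(H)$. $\mathbb{CH}^1$ is the open unit disk; $DA_1$ is the Hardy space with kernels $k_z(w)=(1-\bar zw)^{-1}$; $DA_1(Y)$, $Y$ finite, is the RKHS spanned by $\{k_y\}_{y\in Y}$. *)

theory Defs
  imports
    "HOL-Library.Function_Algebras"
    "HOL-Complex_Analysis.Complex_Analysis"
    "Jordan_Normal_Form.Matrix"
begin

text \<open>A space is the linear span of its kernels inside an ambient complex vector space, so that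
  spaces spanned by fewer kernels live in the same type. The form \<open>inprod\<close> is linear
  in its first argument and is constrained only on that span.\<close>

record ('v, 'x) rkhs =
  points :: "'x set"
  kern :: "'x \<Rightarrow> 'v"
  scale  :: "complex \<Rightarrow> 'v \<Rightarrow> 'v"
  inprod :: "'v \<Rightarrow> 'v \<Rightarrow> complex"

definition rkhs_space :: "('v::ab_group_add, 'x) rkhs \<Rightarrow> 'v set" where
  "rkhs_space H = Modules.module.span (scale H) (kern H ` points H)"

definition inner_product_on ::
    "'v set \<Rightarrow> (complex \<Rightarrow> 'v \<Rightarrow> 'v) \<Rightarrow> ('v::ab_group_add \<Rightarrow> 'v \<Rightarrow> complex) \<Rightarrow> bool" where
  "inner_product_on S scl ip \<longleftrightarrow>
     (\<forall>f\<in>S. \<forall>g\<in>S. \<forall>h\<in>S. ip (f + g) h = ip f h + ip g h) \<and>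
     (\<forall>c. \<forall>f\<in>S. \<forall>g\<in>S. ip (scl c f) g = c * ip f g) \<and>
     (\<forall>f\<in>S. \<forall>g\<in>S. ip g f = cnj (ip f g)) \<and>
     (\<forall>f\<in>S. f \<noteq> 0 \<longrightarrow> Re (ip f f) > 0)"

definition finite_rkhs :: "('v::ab_group_add, 'x) rkhs \<Rightarrow> bool" where
  "finite_rkhs H \<longleftrightarrow>
     vector_space (scale H) \<and>
     finite (points H) \<and>
     inj_on (kern H) (points H) \<and>
     \<not> Modules.module.dependent (scale H) (kern H ` points H) \<and>
     inner_product_on (rkhs_space H) (scale H) (inprod H)"

definition gram :: "('v, 'x) rkhs \<Rightarrow> 'x \<Rightarrow> 'x \<Rightarrow> complex" where
  "gram H x y = inprod H (kern H x) (kern H y)"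

definition value_at :: "('v, 'x) rkhs \<Rightarrow> 'v \<Rightarrow> 'x \<Rightarrow> complex" where
  "value_at H h x = inprod H h (kern H x)"

definition sub_rkhs :: "('v, 'x) rkhs \<Rightarrow> 'x set \<Rightarrow> ('v, 'x) rkhs" where
  "sub_rkhs H Z = H\<lparr>points := Z\<rparr>"

definition delta :: "('v, 'x) rkhs \<Rightarrow> 'x \<Rightarrow> 'x \<Rightarrow> real" where
  "delta H x y = sqrt (1 - (cmod (gram H x y))\<^sup>2 / (Re (gram H x x) * Re (gram H y y)))"

definition LF :: "('v, 'x) rkhs \<Rightarrow> 'x \<Rightarrow> 'x \<Rightarrow> 'x \<Rightarrow> real" where
  "LF H x y z = sqrt (1 / (delta H x y)\<^sup>2 *
     (cmod (1 - gram H y x * gram H x z / (gram H y z * gram H x x)))\<^sup>2)"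

text \<open>On a finite space the kernels form a basis, so a vector is determined by its values and any
  values are attained.\<close>

definition vector_of :: "('v::ab_group_add, 'x) rkhs \<Rightarrow> ('x \<Rightarrow> complex) \<Rightarrow> 'v" where
  "vector_of H u = (THE h. h \<in> rkhs_space H \<and> (\<forall>x\<in>points H. value_at H h x = u x))"

text \<open>The direct sum of \<open>q\<close> copies of a space consists of the \<open>q\<close>-tuples of its vectors. A function
  with values in the \<open>p\<close> by \<open>q\<close> matrices acts from \<open>q\<close>-tuples to \<open>p\<close>-tuples.\<close>

definition tuples :: "('v::ab_group_add, 'x) rkhs \<Rightarrow> nat \<Rightarrow> 'v vec set" where
  "tuples H q = {f \<in> carrier_vec q. \<forall>j<q. vec_index f j \<in> rkhs_space H}"

definition tuple_norm :: "('v, 'x) rkhs \<Rightarrow> 'v vec \<Rightarrow> real" where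
  "tuple_norm H f = sqrt (\<Sum>j<dim_vec f. Re (inprod H (vec_index f j) (vec_index f j)))"

definition mult_op ::
    "('v::ab_group_add, 'x) rkhs \<Rightarrow> nat \<Rightarrow> ('x \<Rightarrow> complex mat) \<Rightarrow> 'v vec \<Rightarrow> 'v vec" where
  "mult_op H p \<phi> f = vec p (\<lambda>i. vector_of H
     (\<lambda>x. vec_index (\<phi> x *\<^sub>v map_vec (\<lambda>h. value_at H h x) f) i))"

definition mult_norm ::
    "('v::ab_group_add, 'x) rkhs \<Rightarrow> nat \<Rightarrow> nat \<Rightarrow> ('x \<Rightarrow> complex mat) \<Rightarrow> real" where
  "mult_norm H p q \<phi> =
     (SUP f \<in> {f \<in> tuples H q. tuple_norm H f \<le> 1}. tuple_norm H (mult_op H p \<phi> f))"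

definition complete_Pick :: "('v::ab_group_add, 'x) rkhs \<Rightarrow> bool" where
  "complete_Pick J \<longleftrightarrow>
     (\<forall>Z\<subseteq>points J. \<forall>p q. \<forall>\<phi>.
        (\<forall>z\<in>Z. \<phi> z \<in> carrier_mat p q) \<and> mult_norm (sub_rkhs J Z) p q \<phi> = 1 \<longrightarrow>
        (\<exists>\<psi>. (\<forall>x\<in>points J. \<psi> x \<in> carrier_mat p q) \<and> (\<forall>z\<in>Z. \<psi> z = \<phi> z) \<and>
             mult_norm J p q \<psi> = 1))"

definition rescaling :: "('v, 'x) rkhs \<Rightarrow> ('w, 'y) rkhs \<Rightarrow> bool"  (infix \<open>\<sim>\<^sub>r\<close> 50) where
  "H \<sim>\<^sub>r H' \<longleftrightarrow>
     (\<exists>\<Xi> \<gamma>. bij_betw \<Xi> (points H) (points H') \<and> (\<forall>x\<in>points H. \<gamma> x \<noteq> 0) \<and>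
        (\<forall>x\<in>points H. \<forall>y\<in>points H. gram H' (\<Xi> x) (\<Xi> y) = \<gamma> x * cnj (\<gamma> y) * gram H x y))"

text \<open>Functions on the open unit disk are represented as functions on the plane that vanish off the
  disk. The Hardy space inner product is the \<open>\<ell>\<^sup>2\<close> product of the Taylor coefficients at \<open>0\<close>.\<close>

definition hardy_kernel :: "complex \<Rightarrow> complex \<Rightarrow> complex" where
  "hardy_kernel z = (\<lambda>w. if w \<in> ball 0 1 then 1 / (1 - cnj z * w) else 0)"

definition hardy_inprod :: "(complex \<Rightarrow> complex) \<Rightarrow> (complex \<Rightarrow> complex) \<Rightarrow> complex" where
  "hardy_inprod f g =
     (\<Sum>n. fps_nth (fps_expansion f 0) n * cnj (fps_nth (fps_expansion g 0) n))"

definition DA1 :: "complex set \<Rightarrow> (complex \<Rightarrow> complex, complex) rkhs" where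
  "DA1 Y = \<lparr>points = Y, kern = hardy_kernel, scale = (\<lambda>c f w. c * f w), inprod = hardy_inprod\<rparr>"

end

theory Submission
  imports Defs
begin

text \<open>Write \<open>F i a b = 1 - k\<^sub>a\<^sub>i k\<^sub>i\<^sub>b / (k\<^sub>a\<^sub>b k\<^sub>i\<^sub>i)\<close>, so that \<open>F i a a = \<delta>\<^sub>i\<^sub>a\<^sup>2\<close> and the condition
  \<open>LF\<^sub>i\<^sub>j\<^sub>k = \<delta>\<^sub>i\<^sub>k\<close> says that the minor of \<open>F i\<close> on \<open>{j, k}\<close> vanishes. Rescaling does not change \<open>F\<close>, and for the
  Hardy space \<open>F i\<close> has rank one. Conversely, \<open>F i\<close> with \<open>i\<close> the first index is the Gram matrix
  \<open>cnj (s a) * s b\<close> of points of the disk, which realise \<open>H\<close>, as soon as the phases of its entries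
  satisfy a cocycle condition on each triple \<open>j, p, q\<close>. Now on \<open>{j, p, q}\<close> the matrix \<open>F j\<close> has rank
  one, say \<open>F j a b = cnj (s a) * s b\<close>, so \<open>(1 - cnj (s a) * s b) k\<^sub>a\<^sub>b\<close> has rank one as well and \<open>s\<close> is a
  scalar multiplier of norm one. By the Pick property it extends to the point \<open>i\<close>; compressing the
  extension to the orthogonal complement of \<open>k\<^sub>i\<close> shows that \<open>F i\<close> is positive semidefinite on
  \<open>{j, p, q}\<close>, which together with the vanishing minors forces the cocycle condition.\<close>

section \<open>Inner product, norm and projection on the span of the kernels\<close>

locale fin_rkhs =
  fixes H :: "('v::ab_group_add, 'x) rkhs"
  assumes fin: "finite_rkhs H"
begin

sublocale vs: vector_space "scale H"
  using fin unfolding finite_rkhs_def by simp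

abbreviation "V \<equiv> rkhs_space H"
abbreviation "ip \<equiv> inprod H"
abbreviation "k \<equiv> kern H"
abbreviation "X \<equiv> points H"
abbreviation "G \<equiv> gram H"

lemma finX: "finite X" and inj: "inj_on k X" and indep: "\<not> vs.dependent (k ` X)"
  using fin unfolding finite_rkhs_def by simp_all

lemma V_eq: "V = vs.span (k ` X)"
  unfolding rkhs_space_def ..

lemma kern_in [simp]: "x \<in> X \<Longrightarrow> k x \<in> V"
  unfolding V_eq by (simp add: vs.span_base)

lemma zero_in [simp]: "0 \<in> V"
  and add_in [simp]: "f \<in> V \<Longrightarrow> g \<in> V \<Longrightarrow> f + g \<in> V"
  and diff_in [simp]: "f \<in> V \<Longrightarrow> g \<in> V \<Longrightarrow> f - g \<in> V"
  and scale_in [simp]: "f \<in> V \<Longrightarrow> scale H c f \<in> V"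
  and sum_in [simp]: "(\<And>a. a \<in> A \<Longrightarrow> F a \<in> V) \<Longrightarrow> sum F A \<in> V"
  unfolding V_eq by (auto intro: vs.span_zero vs.span_add vs.span_diff vs.span_scale vs.span_sum)

lemma ip_add_left: "f \<in> V \<Longrightarrow> g \<in> V \<Longrightarrow> h \<in> V \<Longrightarrow> ip (f + g) h = ip f h + ip g h"
  and ip_scale_left: "f \<in> V \<Longrightarrow> g \<in> V \<Longrightarrow> ip (scale H c f) g = c * ip f g"
  and ip_cnj: "f \<in> V \<Longrightarrow> g \<in> V \<Longrightarrow> cnj (ip f g) = ip g f"
  and ip_pos: "f \<in> V \<Longrightarrow> f \<noteq> 0 \<Longrightarrow> Re (ip f f) > 0"
  using fin unfolding finite_rkhs_def inner_product_on_def by metis+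

lemma ip_add_right: "f \<in> V \<Longrightarrow> g \<in> V \<Longrightarrow> h \<in> V \<Longrightarrow> ip h (f + g) = ip h f + ip h g"
  by (metis add_in complex_cnj_add ip_add_left ip_cnj)

lemma ip_scale_right: "f \<in> V \<Longrightarrow> g \<in> V \<Longrightarrow> ip g (scale H c f) = cnj c * ip g f"
  by (metis scale_in complex_cnj_mult ip_scale_left ip_cnj)

lemma ip_zero_left [simp]: "f \<in> V \<Longrightarrow> ip 0 f = 0"
  by (metis add.right_neutral add_left_cancel ip_add_left zero_in)

lemma ip_zero_right [simp]: "f \<in> V \<Longrightarrow> ip f 0 = 0"
  by (metis complex_cnj_zero ip_cnj ip_zero_left zero_in)

lemma ip_diff_left: "f \<in> V \<Longrightarrow> g \<in> V \<Longrightarrow> h \<in> V \<Longrightarrow> ip (f - g) h = ip f h - ip g h"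
  using ip_add_left[of "f - g" g h] by simp

lemma ip_sum_left: "(\<And>a. a \<in> A \<Longrightarrow> F a \<in> V) \<Longrightarrow> h \<in> V \<Longrightarrow> ip (sum F A) h = (\<Sum>a\<in>A. ip (F a) h)"
  by (induction A rule: infinite_finite_induct) (simp_all add: ip_add_left)

lemma ip_sum_right: "(\<And>a. a \<in> A \<Longrightarrow> F a \<in> V) \<Longrightarrow> h \<in> V \<Longrightarrow> ip h (sum F A) = (\<Sum>a\<in>A. ip h (F a))"
  by (induction A rule: infinite_finite_induct) (simp_all add: ip_add_right)

lemma ip_self_Im: "f \<in> V \<Longrightarrow> Im (ip f f) = 0"
  using ip_cnj[of f f] by (metis add_cancel_right_left complex_cnj_cancel_iff cnj.simps(2) equal_neg_zero)

lemma ip_self: "f \<in> V \<Longrightarrow> ip f f = of_real (Re (ip f f))"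
  by (simp add: complex_eq_iff ip_self_Im)

lemma ip_nonneg: "f \<in> V \<Longrightarrow> Re (ip f f) \<ge> 0"
  by (cases "f = 0") (auto dest: ip_pos)

definition nrm :: "'v \<Rightarrow> real" where "nrm f = sqrt (Re (ip f f))"

lemma nrm_nonneg: "f \<in> V \<Longrightarrow> nrm f \<ge> 0"
  and nrm_sq: "f \<in> V \<Longrightarrow> (nrm f)\<^sup>2 = Re (ip f f)"
  and nrm_pos: "f \<in> V \<Longrightarrow> f \<noteq> 0 \<Longrightarrow> nrm f > 0"
  and nrm_zero [simp]: "nrm 0 = 0"
  unfolding nrm_def by (simp_all add: ip_nonneg ip_pos)

lemma nrm_scale: "f \<in> V \<Longrightarrow> nrm (scale H c f) = cmod c * nrm f"
proof -
  assume f: "f \<in> V"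
  have "ip (scale H c f) (scale H c f) = of_real ((cmod c)\<^sup>2) * ip f f"
    using f by (simp only: ip_scale_left ip_scale_right scale_in complex_norm_square mult_ac)
  then show ?thesis unfolding nrm_def by (simp add: real_sqrt_mult)
qed

lemma ip_add_scale:
  assumes "f \<in> V" "g \<in> V"
  shows "Re (ip (f + scale H c g) (f + scale H c g)) =
    Re (ip f f) + 2 * Re (cnj c * ip f g) + (cmod c)\<^sup>2 * Re (ip g g)"
proof -
  have "ip (f + scale H c g) (f + scale H c g) =
    ip f f + (cnj c * ip f g + cnj (cnj c * ip f g)) + of_real ((cmod c)\<^sup>2) * ip g g"
    using assms by (simp add: ip_add_left ip_add_right ip_scale_left ip_scale_right ip_cnj
        complex_norm_square algebra_simps del: of_real_power)
  then show ?thesis by (simp add: complex_add_cnj)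
qed

text \<open>Completing the square in \<open>c\<close>: the left side is the squared distance from
  \<open>f\<close> to the line of \<open>g\<close>, reached at the orthogonal projection.\<close>

lemma proj_le:
  assumes f: "f \<in> V" and g: "g \<in> V" "g \<noteq> 0"
  shows "Re (ip f f) - (cmod (ip f g))\<^sup>2 / Re (ip g g) \<le> Re (ip (f + scale H c g) (f + scale H c g))"
    and "Re (ip f f) - (cmod (ip f g))\<^sup>2 / Re (ip g g) =
      Re (ip (f + scale H (- ip f g / ip g g) g) (f + scale H (- ip f g / ip g g) g))"
proof -
  define r where "r = Re (ip g g)"
  have r: "r > 0" "ip g g = of_real r" using ip_pos[OF g] ip_self[OF g(1)] by (auto simp: r_def)
  let ?z = "ip f g"
  have "0 \<le> (cmod (of_real r * c + ?z))\<^sup>2 / r" using r by simp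
  also have "(cmod (of_real r * c + ?z))\<^sup>2 = (cmod ?z)\<^sup>2 + 2 * r * Re (cnj c * ?z) + r\<^sup>2 * (cmod c)\<^sup>2"
    unfolding cmod_power2 by (simp add: power2_eq_square algebra_simps)
  also have "\<dots> / r = (cmod ?z)\<^sup>2 / r + 2 * Re (cnj c * ?z) + r * (cmod c)\<^sup>2"
    using r by (simp add: field_simps power2_eq_square)
  finally show "Re (ip f f) - (cmod (ip f g))\<^sup>2 / Re (ip g g) \<le> Re (ip (f + scale H c g) (f + scale H c g))"
    unfolding ip_add_scale[OF f g(1)] r_def[symmetric] by (simp add: algebra_simps)
  have "Re (cnj (- ?z / ip g g) * ?z) = - (cmod ?z)\<^sup>2 / r"
    unfolding r cmod_power2 using r by (simp add: field_simps power2_eq_square)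
  moreover have "(cmod (- ?z / ip g g))\<^sup>2 * r = (cmod ?z)\<^sup>2 / r"
    unfolding r using r by (simp add: norm_divide field_simps power2_eq_square)
  ultimately show "Re (ip f f) - (cmod (ip f g))\<^sup>2 / Re (ip g g) =
      Re (ip (f + scale H (- ip f g / ip g g) g) (f + scale H (- ip f g / ip g g) g))"
    unfolding ip_add_scale[OF f g(1)] r_def[symmetric] by simp
qed

lemma Cauchy_Schwarz:
  assumes "f \<in> V" "g \<in> V"
  shows "cmod (ip f g) \<le> nrm f * nrm g"
proof (cases "g = 0")
  case False
  have "Re (ip f f) - (cmod (ip f g))\<^sup>2 / Re (ip g g) \<ge> 0"
    unfolding proj_le(2)[OF assms False] using assms by (intro ip_nonneg) simp
  then have "(cmod (ip f g))\<^sup>2 \<le> (nrm f * nrm g)\<^sup>2"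
    using ip_pos[OF assms(2) False] assms by (simp add: nrm_sq power_mult_distrib field_simps)
  then show ?thesis by (rule power2_le_imp_le) (use assms in \<open>simp add: nrm_nonneg\<close>)
qed (use assms in simp)

lemma nrm_triangle:
  assumes "f \<in> V" "g \<in> V"
  shows "nrm (f + g) \<le> nrm f + nrm g"
proof -
  have "(nrm (f + g))\<^sup>2 = Re (ip f f) + 2 * Re (ip f g) + Re (ip g g)"
    using ip_add_scale[OF assms, of 1] assms by (simp add: nrm_sq)
  also have "\<dots> \<le> (nrm f + nrm g)\<^sup>2"
    using Cauchy_Schwarz[OF assms] complex_Re_le_cmod[of "ip f g"] assms
    by (simp add: nrm_sq power2_sum)
  finally show ?thesis by (rule power2_le_imp_le) (use assms in \<open>simp add: nrm_nonneg\<close>)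
qed

lemma nrm_sum: "(\<And>a. a \<in> A \<Longrightarrow> F a \<in> V) \<Longrightarrow> nrm (sum F A) \<le> (\<Sum>a\<in>A. nrm (F a))"
  by (induction A rule: infinite_finite_induct) (auto intro: order_trans[OF nrm_triangle])

section \<open>Coordinates in the kernel basis and interpolation of values\<close>

definition comb :: "('x \<Rightarrow> complex) \<Rightarrow> 'v" where
  "comb c = (\<Sum>x\<in>X. scale H (c x) (k x))"

lemma comb_in [simp]: "comb c \<in> V"
  unfolding comb_def by simp

lemma in_V_comb: "f \<in> V \<Longrightarrow> \<exists>c. f = comb c"
proof -
  assume "f \<in> V"
  then obtain u where "f = (\<Sum>v\<in>k ` X. scale H (u v) v)"
    unfolding V_eq using vs.span_finite[of "k ` X"] finX by auto
  then show ?thesis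
    unfolding comb_def by (intro exI[of _ "u \<circ> k"]) (simp add: sum.reindex[OF inj])
qed

lemma ip_comb: "f \<in> V \<Longrightarrow> ip f (comb c) = (\<Sum>x\<in>X. cnj (c x) * value_at H f x)"
  unfolding comb_def value_at_def by (simp add: ip_sum_right ip_scale_right)

lemma kern_nonzero: "x \<in> X \<Longrightarrow> k x \<noteq> 0"
  using indep vs.dependent_zero by (metis imageI)

lemma comb_nonzero:
  assumes "x \<in> X" "c x \<noteq> 0"
  shows "comb c \<noteq> 0"
proof
  assume 0: "comb c = 0"
  have "comb c = (\<Sum>v\<in>k ` X. scale H (c (inv_into X k v)) v)"
    unfolding comb_def by (simp add: sum.reindex[OF inj] inj)
  with 0 have "vs.dependent (k ` X)"
    using assms finX inj by (subst vs.dependent_finite)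
      (auto intro!: exI[of _ "\<lambda>v. c (inv_into X k v)"] bexI[of _ x])
  then show False using indep by simp
qed

text \<open>Gram-Schmidt: subtracting from \<open>k y\<close> the interpolant \<open>h0\<close> of
  its own values on \<open>S\<close> leaves \<open>g\<close> orthogonal to the span over
  \<open>S\<close>, so a multiple of \<open>g\<close> corrects the value at \<open>y\<close> and no
  other. Since \<open>h0\<close> stays in that span, \<open>g\<close> is nonzero by linear
  independence, and its value at \<open>y\<close> is its squared norm.\<close>

lemma values_attained:
  assumes "S \<subseteq> X"
  shows "\<exists>h \<in> vs.span (k ` S). \<forall>x\<in>S. ip h (k x) = u x"
proof -
  have "finite S" using assms finX finite_subset by blast
  then show ?thesis using assms
  proof (induction S arbitrary: u)
    case empty
    then show ?case by (auto simp: vs.span_zero)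
  next
    case (insert y S)
    have sub: "h \<in> V" if "h \<in> vs.span (k ` S)" for h
      using that insert.prems vs.span_mono[of "k ` S" "k ` X"] by (auto simp: V_eq)
    obtain h0 where h0: "h0 \<in> vs.span (k ` S)" "\<forall>x\<in>S. ip h0 (k x) = ip (k y) (k x)"
      using insert.IH[of "\<lambda>x. ip (k y) (k x)"] insert.prems by auto
    obtain h1 where h1: "h1 \<in> vs.span (k ` S)" "\<forall>x\<in>S. ip h1 (k x) = u x"
      using insert.IH[of u] insert.prems by auto
    define g where "g = k y - h0"
    have in_V: "k y \<in> V" "h0 \<in> V" "h1 \<in> V" "g \<in> V"
      using insert.prems h0 h1 sub by (auto simp: g_def)
    have kx: "k x \<in> V" if "x \<in> S" for x using insert.prems that by auto
    have "k y \<notin> vs.span (k ` S)"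
    proof
      assume *: "k y \<in> vs.span (k ` S)"
      have "k ` S \<subseteq> k ` X - {k y}"
        using insert.prems insert.hyps inj by (auto dest: inj_onD)
      with * have "k y \<in> vs.span (k ` X - {k y})" using vs.span_mono by blast
      then show False using indep insert.prems unfolding vs.dependent_def by auto
    qed
    with h0 have "g \<noteq> 0" by (auto simp: g_def)
    have g0: "ip g (k x) = 0" if "x \<in> S" for x
      using that h0 in_V kx by (simp add: g_def ip_diff_left)
    have "h \<in> V \<and> ip h g = 0" if "h \<in> vs.span (k ` S)" for h
      using that
    proof (induction rule: vs.span_induct_alt)
      case base
      then show ?case using in_V by simp
    next
      case (step c v w)
      then have "v \<in> V" "w \<in> V" using kx by auto
      moreover have "ip v g = 0"
        using step(1) g0 kx in_V ip_cnj by (metis complex_cnj_zero imageE)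
      ultimately show ?case using step(2) in_V by (simp add: ip_add_left ip_scale_left)
    qed
    then have "ip g h0 = 0" using h0 in_V by (metis complex_cnj_zero ip_cnj)
    then have "ip g (k y) = ip g g"
      using ip_add_right[of g h0 g] in_V by (simp add: g_def)
    then have gy: "ip g (k y) \<noteq> 0" using ip_pos[of g] in_V \<open>g \<noteq> 0\<close> by auto
    define t where "t = (u y - ip h1 (k y)) / ip g (k y)"
    have "k y \<in> vs.span (k ` insert y S)" by (intro vs.span_base) simp
    moreover have mono: "h \<in> vs.span (k ` S) \<Longrightarrow> h \<in> vs.span (k ` insert y S)" for h
      using vs.span_mono[of "k ` S" "k ` insert y S"] by auto
    ultimately have "h1 + scale H t g \<in> vs.span (k ` insert y S)"
      using h0 h1 unfolding g_def by (intro vs.span_add vs.span_scale vs.span_diff) auto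
    moreover have "\<forall>x\<in>insert y S. ip (h1 + scale H t g) (k x) = u x"
      using h1 gy g0 in_V kx insert.hyps
      by (auto simp: ip_add_left ip_scale_left t_def)
    ultimately show ?case by blast
  qed
qed

text \<open>The difference is a combination of kernels and orthogonal to each of them, hence to
  itself.\<close>

lemma values_determine:
  assumes "f \<in> V" "g \<in> V" "\<And>x. x \<in> X \<Longrightarrow> value_at H f x = value_at H g x"
  shows "f = g"
proof -
  obtain c where c: "f - g = comb c" using in_V_comb[of "f - g"] assms by auto
  have "ip (f - g) (comb c) = 0"
    using assms by (simp add: ip_comb) (simp add: value_at_def ip_diff_left)
  then show ?thesis using ip_pos[of "f - g"] assms c by force
qed

lemma vector_of: "vector_of H u \<in> V" "x \<in> X \<Longrightarrow> value_at H (vector_of H u) x = u x"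
proof -
  have "\<exists>!h. h \<in> V \<and> (\<forall>x\<in>X. value_at H h x = u x)"
    using values_attained[of X u] values_determine by (auto simp: value_at_def V_eq)
  from theI'[OF this]
  show "vector_of H u \<in> V" "x \<in> X \<Longrightarrow> value_at H (vector_of H u) x = u x"
    unfolding vector_of_def by auto
qed

section \<open>Scalar multipliers, their adjoints and their norm\<close>

definition mul :: "('x \<Rightarrow> complex) \<Rightarrow> 'v \<Rightarrow> 'v" where
  "mul s f = vector_of H (\<lambda>x. s x * value_at H f x)"

lemma mul_in [simp]: "mul s f \<in> V"
  unfolding mul_def by (rule vector_of)

text \<open>This identifies the adjoint of \<open>mul s\<close>: it is diagonal in the kernel basis,
  with eigenvalue \<open>cnj (s x)\<close> at \<open>k x\<close>.\<close>

lemma mul_adjoint: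
  assumes "f \<in> V"
  shows "ip (mul s f) (comb c) = ip f (comb (\<lambda>x. cnj (s x) * c x))"
  using assms by (simp add: ip_comb) (simp add: mul_def vector_of mult_ac)

lemma mul_scale:
  assumes "f \<in> V"
  shows "mul s (scale H c f) = scale H c (mul s f)"
  by (rule values_determine) (use assms in \<open>simp_all add: vector_of mul_def\<close>,
    simp add: value_at_def ip_scale_left vector_of vector_of[unfolded value_at_def] assms)

text \<open>Expansion in the basis \<open>e\<close> dual to the kernels gives a crude constant,
  which makes the supremum in \<open>mult_norm\<close> one over a bounded set.\<close>

lemma mul_bounded: "\<exists>C. \<forall>f\<in>V. nrm (mul s f) \<le> C * nrm f"
proof -
  define e where "e y = vector_of H (\<lambda>x. if x = y then 1 else 0)" for y
  have e: "e y \<in> V" "x \<in> X \<Longrightarrow> ip (e y) (k x) = (if x = y then 1 else 0)" for x y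
    using vector_of unfolding e_def value_at_def by auto
  have eq: "mul s f = (\<Sum>y\<in>X. scale H (s y * value_at H f y) (e y))" if "f \<in> V" for f
  proof (rule values_determine)
    fix x assume "x \<in> X"
    then show "value_at H (mul s f) x = value_at H (\<Sum>y\<in>X. scale H (s y * value_at H f y) (e y)) x"
      unfolding mul_def using finX e
      by (simp add: vector_of, simp add: value_at_def ip_sum_left ip_scale_left if_distrib[of "(*) _"] del: if_split cong: if_cong)
  qed (simp_all add: e)
  show ?thesis
  proof (intro exI ballI)
    fix f assume f: "f \<in> V"
    have "nrm (mul s f) \<le> (\<Sum>y\<in>X. nrm (scale H (s y * value_at H f y) (e y)))"
      unfolding eq[OF f] by (rule nrm_sum) (simp add: e)
    also have "\<dots> \<le> (\<Sum>y\<in>X. cmod (s y) * nrm (k y) * nrm (e y) * nrm f)"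
    proof (rule sum_mono)
      fix y assume y: "y \<in> X"
      have "cmod (value_at H f y) \<le> nrm f * nrm (k y)"
        unfolding value_at_def using f y by (intro Cauchy_Schwarz) auto
      then have "(cmod (s y) * nrm (e y)) * cmod (value_at H f y) \<le>
          (cmod (s y) * nrm (e y)) * (nrm f * nrm (k y))"
        using e nrm_nonneg by (intro mult_left_mono) auto
      then show "nrm (scale H (s y * value_at H f y) (e y)) \<le>
          cmod (s y) * nrm (k y) * nrm (e y) * nrm f"
        using e by (simp add: nrm_scale norm_mult mult_ac)
    qed
    finally show "nrm (mul s f) \<le> (\<Sum>y\<in>X. cmod (s y) * nrm (k y) * nrm (e y)) * nrm f"
      by (simp add: sum_distrib_right)
  qed
qed

text \<open>One-tuples are vectors and 1 by 1 matrices are numbers; this reduces the matrix notion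
  of \<open>mult_norm\<close> to \<open>mul\<close>.\<close>

lemma mult_norm_scalar:
  assumes "\<And>x. x \<in> X \<Longrightarrow> \<phi> x \<in> carrier_mat 1 1"
  shows "mult_norm H 1 1 \<phi> = (SUP f\<in>{f\<in>V. nrm f \<le> 1}. nrm (mul (\<lambda>x. \<phi> x $$ (0,0)) f))"
proof -
  have tn: "tuple_norm H f = nrm (vec_index f 0)" if "dim_vec f = 1" for f :: "'v vec"
    using that by (simp add: tuple_norm_def nrm_def)
  have op: "tuple_norm H (mult_op H 1 \<phi> f) = nrm (mul (\<lambda>x. \<phi> x $$ (0,0)) (vec_index f 0))"
    if f: "dim_vec f = 1" for f :: "'v vec"
  proof -
    let ?u = "\<lambda>x. vec_index (\<phi> x *\<^sub>v map_vec (\<lambda>h. value_at H h x) f) 0"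
    have "vector_of H ?u = mul (\<lambda>x. \<phi> x $$ (0,0)) (vec_index f 0)"
    proof (rule values_determine)
      fix x assume x: "x \<in> X"
      have "dim_row (\<phi> x) = 1" "dim_col (\<phi> x) = 1" using assms[OF x] by auto
      then show "value_at H (vector_of H ?u) x = value_at H (mul (\<lambda>x. \<phi> x $$ (0,0)) (vec_index f 0)) x"
        using x f by (simp add: mul_def vector_of scalar_prod_def)
    qed (simp_all add: vector_of)
    then show ?thesis by (subst tn) (simp_all add: mult_op_def)
  qed
  have "(\<lambda>f. tuple_norm H (mult_op H 1 \<phi> f)) ` {f \<in> tuples H 1. tuple_norm H f \<le> 1} =
      (\<lambda>f. nrm (mul (\<lambda>x. \<phi> x $$ (0,0)) f)) ` {f\<in>V. nrm f \<le> 1}" (is "?A = ?B")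
  proof
    show "?A \<subseteq> ?B" by (auto simp: tuples_def op tn simp del: One_nat_def)
    show "?B \<subseteq> ?A"
    proof
      fix r assume "r \<in> ?B"
      then obtain f where f: "f \<in> V" "nrm f \<le> 1" "r = nrm (mul (\<lambda>x. \<phi> x $$ (0,0)) f)" by auto
      show "r \<in> ?A"
        by (rule image_eqI[of _ _ "vec 1 (\<lambda>_. f)"]) (use f in \<open>auto simp: tuples_def op tn simp del: One_nat_def\<close>)
    qed
  qed
  then show ?thesis unfolding mult_norm_def by simp
qed

text \<open>By homogeneity \<open>f\<close> may be scaled to norm one, where the supremum is an
  upper bound because \<open>mul_bounded\<close> makes the set bounded.\<close>

lemma mul_le_of_mult_norm:
  assumes "\<And>x. x \<in> X \<Longrightarrow> \<phi> x \<in> carrier_mat 1 1" "mult_norm H 1 1 \<phi> = 1" "f \<in> V"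
  shows "nrm (mul (\<lambda>x. \<phi> x $$ (0,0)) f) \<le> nrm f"
proof (cases "f = 0")
  case True
  then have "mul (\<lambda>x. \<phi> x $$ (0,0)) f = 0"
    using mul_scale[of 0 "\<lambda>x. \<phi> x $$ (0,0)" 0] by simp
  then show ?thesis using True by simp
next
  case False
  let ?s = "\<lambda>x. \<phi> x $$ (0,0)"
  obtain C where C: "\<forall>f\<in>V. nrm (mul ?s f) \<le> C * nrm f" using mul_bounded by blast
  have "bdd_above ((\<lambda>f. nrm (mul ?s f)) ` {f\<in>V. nrm f \<le> 1})"
  proof (rule bdd_aboveI2[of _ _ "\<bar>C\<bar>"])
    fix f assume f: "f \<in> {f\<in>V. nrm f \<le> 1}"
    then have "nrm (mul ?s f) \<le> C * nrm f" using C by auto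
    also have "\<dots> \<le> \<bar>C\<bar> * nrm f" using f nrm_nonneg by (intro mult_right_mono) auto
    also have "\<dots> \<le> \<bar>C\<bar> * 1" using f by (intro mult_left_mono) auto
    finally show "nrm (mul ?s f) \<le> \<bar>C\<bar>" by simp
  qed
  then have le: "nrm (mul ?s g) \<le> 1" if "g \<in> V" "nrm g \<le> 1" for g
    using cSUP_upper[of g "{f\<in>V. nrm f \<le> 1}" "\<lambda>f. nrm (mul ?s f)"] that assms(2) mult_norm_scalar[OF assms(1)]
    by simp
  have p: "nrm f > 0" using nrm_pos assms False by blast
  show ?thesis
    using le[of "scale H (of_real (1 / nrm f)) f"] p assms(3)
    by (simp add: mul_scale nrm_scale norm_divide field_simps)
qed

text \<open>The supremum is a maximum, attained at the normalised \<open>g\<close>. The value must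
  be exactly one, since \<open>complete_Pick\<close> speaks only of multipliers of norm one.\<close>

lemma mult_norm_eq_1I:
  assumes "\<And>x. x \<in> X \<Longrightarrow> \<phi> x \<in> carrier_mat 1 1"
    and "\<And>f. f \<in> V \<Longrightarrow> nrm (mul (\<lambda>x. \<phi> x $$ (0,0)) f) \<le> nrm f"
    and g: "g \<in> V" "g \<noteq> 0" "nrm (mul (\<lambda>x. \<phi> x $$ (0,0)) g) = nrm g"
  shows "mult_norm H 1 1 \<phi> = 1"
proof -
  let ?s = "\<lambda>x. \<phi> x $$ (0,0)"
  let ?g = "scale H (of_real (1 / nrm g)) g"
  have p: "nrm g > 0" using nrm_pos g by blast
  then have n: "?g \<in> V" "nrm ?g = 1" "nrm (mul ?s ?g) = 1"
    using g by (simp_all add: mul_scale nrm_scale norm_divide)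
  have "(SUP f\<in>{f\<in>V. nrm f \<le> 1}. nrm (mul ?s f)) = 1"
  proof (rule cSup_eq_maximum)
    show "1 \<in> (\<lambda>f. nrm (mul ?s f)) ` {f\<in>V. nrm f \<le> 1}"
      by (rule image_eqI[of _ _ ?g]) (use n in auto)
  qed (use assms(2) order_trans in auto)
  then show ?thesis using mult_norm_scalar[of \<phi>] assms(1) by simp
qed

text \<open>An operator and its adjoint have the same norm: the squared norm of an image is an inner
  product by \<open>mul_adjoint\<close>, Cauchy-Schwarz bounds it, and one factor cancels.\<close>

lemma mul_contraction_iff:
  "(\<forall>f\<in>V. nrm (mul s f) \<le> nrm f) \<longleftrightarrow> (\<forall>c. nrm (comb (\<lambda>x. cnj (s x) * c x)) \<le> nrm (comb c))"
proof safe
  fix c assume le: "\<forall>f\<in>V. nrm (mul s f) \<le> nrm f"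
  let ?f = "comb (\<lambda>x. cnj (s x) * c x)"
  have "(nrm ?f)\<^sup>2 = Re (ip (mul s ?f) (comb c))" by (simp add: mul_adjoint nrm_sq)
  also have "\<dots> \<le> nrm (mul s ?f) * nrm (comb c)"
    using Cauchy_Schwarz[of "mul s ?f" "comb c"] complex_Re_le_cmod order_trans by fastforce
  also have "\<dots> \<le> nrm ?f * nrm (comb c)" using le by (intro mult_right_mono) (auto simp: nrm_nonneg)
  finally show "nrm ?f \<le> nrm (comb c)"
    using nrm_nonneg[of ?f] nrm_nonneg[of "comb c"]
    by (cases "nrm ?f = 0") (auto simp: power2_eq_square)
next
  fix f assume le: "\<forall>c. nrm (comb (\<lambda>x. cnj (s x) * c x)) \<le> nrm (comb c)" and f: "f \<in> V"
  obtain c where c: "mul s f = comb c" using in_V_comb[of "mul s f"] by auto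
  have "(nrm (mul s f))\<^sup>2 = Re (ip (mul s f) (comb c))" by (simp add: c nrm_sq)
  also have "\<dots> = Re (ip f (comb (\<lambda>x. cnj (s x) * c x)))" using f by (simp add: mul_adjoint)
  also have "\<dots> \<le> nrm f * nrm (comb (\<lambda>x. cnj (s x) * c x))"
    using Cauchy_Schwarz[of f "comb (\<lambda>x. cnj (s x) * c x)"] complex_Re_le_cmod order_trans f by fastforce
  also have "\<dots> \<le> nrm f * nrm (mul s f)" using le c f by (intro mult_left_mono) (auto simp: nrm_nonneg)
  finally show "nrm (mul s f) \<le> nrm f"
    using nrm_nonneg[OF f] nrm_nonneg[of "mul s f"]
    by (cases "nrm (mul s f) = 0") (auto simp: power2_eq_square)
qed

text \<open>Write \<open>f\<close> for the adjoint image of \<open>comb c\<close>. Its squared norm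
  is \<open>ip (mul s f) (comb c)\<close>, and \<open>comb c\<close> has the norm of
  \<open>f\<close>, so Cauchy-Schwarz bounds the norm of \<open>mul s f\<close> from below. This
  yields the vector required by \<open>mult_norm_eq_1I\<close>.\<close>

lemma mul_attains:
  assumes "\<forall>f\<in>V. nrm (mul s f) \<le> nrm f"
    and eq: "nrm (comb (\<lambda>x. cnj (s x) * c x)) = nrm (comb c)"
  shows "nrm (mul s (comb (\<lambda>x. cnj (s x) * c x))) = nrm (comb (\<lambda>x. cnj (s x) * c x))"
proof -
  let ?f = "comb (\<lambda>x. cnj (s x) * c x)"
  have "(nrm ?f)\<^sup>2 = Re (ip (mul s ?f) (comb c))" by (simp add: mul_adjoint nrm_sq)
  also have "\<dots> \<le> nrm (mul s ?f) * nrm ?f"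
    using Cauchy_Schwarz[of "mul s ?f" "comb c"] complex_Re_le_cmod[of "ip (mul s ?f) (comb c)"]
    by (simp add: eq)
  finally have "nrm ?f \<le> nrm (mul s ?f)"
    using nrm_nonneg[of ?f] nrm_nonneg[of "mul s ?f"]
    by (cases "nrm ?f = 0") (auto simp: power2_eq_square)
  then show ?thesis using assms(1) by (simp add: antisym)
qed

lemma ip_comb_comb: "ip (comb c) (comb d) = (\<Sum>x\<in>X. \<Sum>y\<in>X. c x * cnj (d y) * G x y)"
  unfolding comb_def gram_def
  by (simp add: ip_sum_left ip_sum_right ip_scale_left ip_scale_right sum_distrib_left mult_ac, rule sum.swap)

lemma gram_cnj: "x \<in> X \<Longrightarrow> y \<in> X \<Longrightarrow> cnj (G x y) = G y x"
  unfolding gram_def by (simp add: ip_cnj)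

lemma gram_self: "x \<in> X \<Longrightarrow> G x x = of_real (Re (G x x))"
  unfolding gram_def by (simp add: ip_self[symmetric])

lemma gram_pos: "x \<in> X \<Longrightarrow> Re (G x x) > 0"
  unfolding gram_def by (simp add: ip_pos kern_nonzero)

text \<open>Strictness is linear independence: the projection of \<open>k x\<close> off
  \<open>k y\<close> has coefficient 1 at \<open>x\<close>, so it is nonzero.\<close>

lemma gram_strict:
  assumes "x \<in> X" "y \<in> X" "x \<noteq> y"
  shows "(cmod (G x y))\<^sup>2 < Re (G x x) * Re (G y y)"
proof -
  let ?c = "- G x y / G y y"
  let ?d = "\<lambda>z. if z = x then 1 else if z = y then ?c else 0"
  have "comb ?d = k x + scale H ?c (k y)"
  proof -
    have "comb ?d = (\<Sum>z\<in>{x,y}. scale H (?d z) (k z))"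
      unfolding comb_def using assms finX by (intro sum.mono_neutral_right) auto
    then show ?thesis using assms by simp
  qed
  moreover have "comb ?d \<noteq> 0" using comb_nonzero[of x ?d] assms by simp
  ultimately have "Re (ip (k x + scale H ?c (k y)) (k x + scale H ?c (k y))) > 0"
    using assms by (intro ip_pos) auto
  then have "Re (G x x) - (cmod (G x y))\<^sup>2 / Re (G y y) > 0"
    using proj_le(2)[of "k x" "k y"] assms kern_nonzero unfolding gram_def by simp
  then show ?thesis using gram_pos[OF assms(2)] by (simp add: field_simps)
qed

end

section \<open>Subspaces, extremal multipliers and the positivity drawn from the Pick
  property\<close>

lemma inner_product_on_subset:
  assumes "S \<subseteq> T" "inner_product_on T scl ip"
  shows "inner_product_on S scl ip"
  using assms(2) unfolding inner_product_on_def by (meson subsetD[OF assms(1)])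

lemma (in fin_rkhs) sub_rkhs:
  assumes Z: "Z \<subseteq> points H"
  shows "fin_rkhs (sub_rkhs H Z)"
proof
  have sub: "k ` Z \<subseteq> k ` points H" using Z by blast
  have "rkhs_space (sub_rkhs H Z) \<subseteq> V"
    using vs.span_mono[OF sub] by (simp add: rkhs_space_def sub_rkhs_def)
  moreover have "inner_product_on V (scale H) ip"
    using fin by (simp add: finite_rkhs_def)
  ultimately have "inner_product_on (rkhs_space (sub_rkhs H Z)) (scale H) ip"
    by (rule inner_product_on_subset)
  moreover have "\<not> vs.dependent (k ` Z)"
    using indep vs.dependent_mono[OF _ sub] by blast
  ultimately show "finite_rkhs (sub_rkhs H Z)"
    using vs.vector_space_axioms finite_subset[OF Z finX] inj_on_subset[OF inj Z]
    unfolding finite_rkhs_def by (simp add: sub_rkhs_def)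
qed

lemma gram_sub_rkhs [simp]: "gram (sub_rkhs H Z) = gram H"
  and points_sub_rkhs [simp]: "points (sub_rkhs H Z) = Z"
  by (auto simp: gram_def sub_rkhs_def fun_eq_iff)

text \<open>The matrix of the McCullough-Quiggin criterion for complete Pick kernels. If the kernel
  is normalised to be 1 at \<open>i\<close>, its entries are
  \<open>1 - 1 / gram H a b\<close>.\<close>

definition pick_entry :: "('v, 'x) rkhs \<Rightarrow> 'x \<Rightarrow> 'x \<Rightarrow> 'x \<Rightarrow> complex" where
  "pick_entry H i a b = 1 - gram H a i * gram H i b / (gram H a b * gram H i i)"

lemma pick_entry_sub_rkhs [simp]: "pick_entry (sub_rkhs H Z) = pick_entry H"
  by (simp add: pick_entry_def fun_eq_iff)

text \<open>The left side is the squared norm of \<open>comb c\<close> projected off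
  \<open>k i\<close>; the matrix on the right, a Schur complement, is the Gram matrix of the
  projected kernels.\<close>

lemma (in fin_rkhs) compression_comb:
  assumes i: "i \<in> X"
  shows "Re (ip (comb c) (comb c)) - (cmod (ip (comb c) (k i)))\<^sup>2 / Re (ip (k i) (k i)) =
    Re (\<Sum>a\<in>X. \<Sum>b\<in>X. c a * cnj (c b) * (G a b - G a i * G i b / G i i))"
proof -
  have v: "ip (comb c) (k i) = (\<Sum>a\<in>X. c a * G a i)"
    unfolding comb_def gram_def using i by (simp add: ip_sum_left ip_scale_left)
  then have "cnj (ip (comb c) (k i)) = (\<Sum>b\<in>X. cnj (c b) * G i b)"
    using i by (simp add: gram_cnj)
  with v have sq: "of_real ((cmod (ip (comb c) (k i)))\<^sup>2) =
      (\<Sum>a\<in>X. \<Sum>b\<in>X. c a * cnj (c b) * (G a i * G i b))"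
    unfolding complex_norm_square by (simp add: sum_product mult_ac)
  define r where "r = Re (ip (k i) (k i))"
  have r: "G i i = of_real r" unfolding r_def gram_def using i by (simp add: ip_self[symmetric])
  have "(cmod (ip (comb c) (k i)))\<^sup>2 / r = Re (of_real ((cmod (ip (comb c) (k i)))\<^sup>2) / of_real r)"
    by (metis Re_complex_of_real of_real_divide)
  also have "\<dots> = Re (\<Sum>a\<in>X. \<Sum>b\<in>X. c a * cnj (c b) * (G a i * G i b / G i i))"
    unfolding sq r by (simp add: sum_divide_distrib)
  finally show ?thesis
    unfolding r_def[symmetric] ip_comb_comb
    by (simp add: right_diff_distrib sum_subtractf)
qed

lemma (in fin_rkhs) compression_contraction:
  assumes i: "i \<in> X" and s: "\<forall>f\<in>V. nrm (mul s f) \<le> nrm f"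
  shows "0 \<le> Re (\<Sum>a\<in>X. \<Sum>b\<in>X. c a * cnj (c b) * (1 - cnj (s a) * s b) * (G a b - G a i * G i b / G i i))"
proof -
  let ?e = "\<lambda>t. \<lambda>x. if x = i then t else 0"
  have add: "comb (\<lambda>x. d x + ?e t x) = comb d + scale H t (k i)" for d t
  proof -
    have "scale H (d x + ?e t x) (k x) = scale H (d x) (k x) + (if x = i then scale H t (k i) else 0)" for x
      by (simp add: vs.scale_left_distrib)
    then show ?thesis
      unfolding comb_def using i finX by (simp add: sum.distrib)
  qed
  let ?S = "\<lambda>d x. cnj (s x) * d x"
  \<comment> \<open>The adjoint multiplier keeps the line of \<open>k i\<close>, so only the projection of \<open>comb c\<close> off \<open>k i\<close> matters.\<close>
  define t where "t = - ip (comb c) (k i) / ip (k i) (k i)"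
  define c' where "c' = (\<lambda>x. c x + ?e t x)"
  have c': "comb c' = comb c + scale H t (k i)" unfolding c'_def by (rule add)
  have "?S c' = (\<lambda>x. ?S c x + ?e (cnj (s i) * t) x)"
    unfolding c'_def by (auto simp: algebra_simps)
  then have Sc': "comb (?S c') = comb (?S c) + scale H (cnj (s i) * t) (k i)"
    by (simp only: add)
  \<comment> \<open>The coefficient \<open>t\<close> is optimal for \<open>comb c\<close>, but
    \<open>cnj (s i) * t\<close> need not be for \<open>comb (?S c)\<close>: hence an inequality
    here and an equality at the end of the chain.\<close>
  have "Re (ip (comb (?S c)) (comb (?S c))) - (cmod (ip (comb (?S c)) (k i)))\<^sup>2 / Re (ip (k i) (k i))
    \<le> Re (ip (comb (?S c')) (comb (?S c')))"
    unfolding Sc' by (rule proj_le) (simp_all add: i kern_nonzero)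
  also have "\<dots> = (nrm (comb (?S c')))\<^sup>2" by (simp add: nrm_sq)
  also have "\<dots> \<le> (nrm (comb c'))\<^sup>2"
    using s unfolding mul_contraction_iff by (intro power_mono) (auto simp: nrm_nonneg)
  also have "\<dots> = Re (ip (comb c') (comb c'))" by (simp add: nrm_sq)
  also have "\<dots> = Re (ip (comb c) (comb c)) - (cmod (ip (comb c) (k i)))\<^sup>2 / Re (ip (k i) (k i))"
    unfolding c' t_def by (rule proj_le(2)[symmetric]) (simp_all add: i kern_nonzero)
  finally have "0 \<le> Re ((\<Sum>a\<in>X. \<Sum>b\<in>X. c a * cnj (c b) * (G a b - G a i * G i b / G i i)) -
      (\<Sum>a\<in>X. \<Sum>b\<in>X. ?S c a * cnj (?S c b) * (G a b - G a i * G i b / G i i)))"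
    unfolding compression_comb[OF i] by simp
  also have "(\<Sum>a\<in>X. \<Sum>b\<in>X. c a * cnj (c b) * (G a b - G a i * G i b / G i i)) -
      (\<Sum>a\<in>X. \<Sum>b\<in>X. ?S c a * cnj (?S c b) * (G a b - G a i * G i b / G i i)) =
      (\<Sum>a\<in>X. \<Sum>b\<in>X. c a * cnj (c b) * (1 - cnj (s a) * s b) * (G a b - G a i * G i b / G i i))"
    unfolding sum_subtractf[symmetric] by (intro sum.cong refl) (simp add: algebra_simps)
  finally show ?thesis .
qed

text \<open>By \<open>fac\<close> the defect, identity minus multiplier times adjoint, is the
  squared modulus of a linear functional of the coefficients. Nonnegativity gives a contraction;
  with two points available the functional kills a nonzero vector, on which the adjoint is
  isometric, so the norm is exactly one.\<close>

lemma (in fin_rkhs) extremal_multiplier: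
  assumes fac: "\<And>a b. a \<in> X \<Longrightarrow> b \<in> X \<Longrightarrow> (1 - cnj (s a) * s b) * G a b = \<gamma> a * cnj (\<gamma> b)"
    and nz: "\<And>a. a \<in> X \<Longrightarrow> \<gamma> a \<noteq> 0"
    and ab: "a\<^sub>0 \<in> X" "b\<^sub>0 \<in> X" "a\<^sub>0 \<noteq> b\<^sub>0"
  shows "mult_norm H 1 1 (\<lambda>x. mat 1 1 (\<lambda>_. s x)) = 1"
proof -
  let ?S = "\<lambda>d x. cnj (s x) * d x"
  have defect: "(nrm (comb c))\<^sup>2 - (nrm (comb (?S c)))\<^sup>2 = (cmod (\<Sum>a\<in>X. c a * \<gamma> a))\<^sup>2" for c
  proof -
    have "complex_of_real ((cmod (\<Sum>a\<in>X. c a * \<gamma> a))\<^sup>2) =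
        (\<Sum>a\<in>X. \<Sum>b\<in>X. c a * cnj (c b) * (\<gamma> a * cnj (\<gamma> b)))"
      unfolding complex_norm_square by (simp add: sum_product mult_ac)
    also have "\<dots> = (\<Sum>a\<in>X. \<Sum>b\<in>X. c a * cnj (c b) * ((1 - cnj (s a) * s b) * G a b))"
      by (intro sum.cong refl) (simp add: fac)
    also have "\<dots> = ip (comb c) (comb c) - ip (comb (?S c)) (comb (?S c))"
      unfolding ip_comb_comb sum_subtractf[symmetric]
      by (intro sum.cong refl) (simp add: algebra_simps)
    finally have "Re (complex_of_real ((cmod (\<Sum>a\<in>X. c a * \<gamma> a))\<^sup>2)) =
        Re (ip (comb c) (comb c) - ip (comb (?S c)) (comb (?S c)))" by simp
    then show ?thesis unfolding Re_complex_of_real by (simp add: nrm_sq)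
  qed
  have "(nrm (comb (?S c)))\<^sup>2 \<le> (nrm (comb c))\<^sup>2" for c
    by (rule diff_ge_0_iff_ge[THEN iffD1]) (simp only: defect zero_le_power2)
  then have "nrm (comb (?S c)) \<le> nrm (comb c)" for c
    by (rule power2_le_imp_le) (simp add: nrm_nonneg)
  then have le: "\<forall>f\<in>V. nrm (mul s f) \<le> nrm f" unfolding mul_contraction_iff by blast
  \<comment> \<open>Chosen to be killed by the functional: the two terms are
    \<open>\<gamma> b\<^sub>0 * \<gamma> a\<^sub>0\<close> and its negative.\<close>
  define c where "c x = (if x = a\<^sub>0 then \<gamma> b\<^sub>0 else if x = b\<^sub>0 then - \<gamma> a\<^sub>0 else 0)" for x
  have "(\<Sum>a\<in>X. c a * \<gamma> a) = (\<Sum>a\<in>{a\<^sub>0,b\<^sub>0}. c a * \<gamma> a)"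
    using ab finX by (intro sum.mono_neutral_right) (auto simp: c_def)
  also have "\<dots> = 0" using ab by (simp add: c_def)
  finally have "(nrm (comb c))\<^sup>2 = (nrm (comb (?S c)))\<^sup>2" using defect[of c] by simp
  then have eq: "nrm (comb (?S c)) = nrm (comb c)"
    using nrm_nonneg by (simp add: power2_eq_iff_nonneg)
  have "comb c \<noteq> 0" using comb_nonzero[of a\<^sub>0 c] ab nz by (simp add: c_def)
  then have "nrm (comb (?S c)) > 0" unfolding eq by (intro nrm_pos) auto
  then have "comb (?S c) \<noteq> 0" by auto
  then show ?thesis
    using mult_norm_eq_1I[of "\<lambda>x. mat 1 1 (\<lambda>_. s x)" "comb (?S c)"] le mul_attains[OF le eq]
    by simp
qed

text \<open>Extending \<open>s\<close> to \<open>i\<close> with norm one and compressing gives a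
  positive form on \<open>Z\<close> with entries
  \<open>(1 - cnj (s a) * s b) * gram J a b * pick_entry J i a b\<close>. The first two factors form
  a rank one matrix without zeros, which can be divided out.\<close>

lemma pick_entry_psd:
  assumes J: "fin_rkhs J" "complete_Pick J" and i: "i \<in> points J"
    and nzG: "\<And>a b. a \<in> points J \<Longrightarrow> b \<in> points J \<Longrightarrow> gram J a b \<noteq> 0"
    and Z: "Z = points J - {i}"
    and fac: "\<And>a b. a \<in> Z \<Longrightarrow> b \<in> Z \<Longrightarrow> (1 - cnj (s a) * s b) * gram J a b = \<gamma> a * cnj (\<gamma> b)"
    and nz: "\<And>a. a \<in> Z \<Longrightarrow> \<gamma> a \<noteq> 0"
    and ab: "a\<^sub>0 \<in> Z" "b\<^sub>0 \<in> Z" "a\<^sub>0 \<noteq> b\<^sub>0"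
  shows "0 \<le> Re (\<Sum>a\<in>Z. \<Sum>b\<in>Z. d a * cnj (d b) * pick_entry J i a b)"
proof -
  interpret J: fin_rkhs J by (rule J)
  have ZJ: "Z \<subseteq> points J" using Z by auto
  interpret K: fin_rkhs "sub_rkhs J Z" by (rule J.sub_rkhs[OF ZJ])
  let ?\<phi> = "\<lambda>x. mat 1 1 (\<lambda>_. s x)"
  have "mult_norm (sub_rkhs J Z) 1 1 ?\<phi> = 1"
    by (rule K.extremal_multiplier[where \<gamma> = \<gamma> and a\<^sub>0 = a\<^sub>0 and b\<^sub>0 = b\<^sub>0]) (use fac nz ab in simp_all)
  then have ext: "(\<forall>z\<in>Z. ?\<phi> z \<in> carrier_mat 1 1) \<and> mult_norm (sub_rkhs J Z) 1 1 ?\<phi> = 1"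
    by simp
  obtain \<psi> where \<psi>: "\<forall>x\<in>points J. \<psi> x \<in> carrier_mat 1 1"
    "\<forall>z\<in>Z. \<psi> z = mat 1 1 (\<lambda>_. s z)" "mult_norm J 1 1 \<psi> = 1"
    using J(2)[unfolded complete_Pick_def, rule_format, OF ZJ ext] by blast
  define s' where "s' x = \<psi> x $$ (0,0)" for x
  have s': "s' z = s z" if "z \<in> Z" for z using \<psi>(2) that by (simp add: s'_def)
  have le: "\<forall>f\<in>rkhs_space J. J.nrm (J.mul s' f) \<le> J.nrm f"
    unfolding s'_def using \<psi> J.mul_le_of_mult_norm by blast
  \<comment> \<open>Division by \<open>\<gamma>\<close> absorbs the rank one factor, and the zero at
    \<open>i\<close> removes every term with the unknown value \<open>s' i\<close>.\<close>
  define c where "c a = (if a = i then 0 else d a / \<gamma> a)" for a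
  let ?t = "\<lambda>a b. c a * cnj (c b) * (1 - cnj (s' a) * s' b) *
      (gram J a b - gram J a i * gram J i b / gram J i i)"
  have "0 \<le> Re (\<Sum>a\<in>points J. \<Sum>b\<in>points J. ?t a b)"
    by (rule J.compression_contraction[OF i le])
  also have "(\<Sum>a\<in>points J. \<Sum>b\<in>points J. ?t a b) = (\<Sum>a\<in>Z. \<Sum>b\<in>Z. ?t a b)"
    using Z ZJ J.finX by (intro sum.mono_neutral_cong_right) (auto simp: c_def intro!: sum.neutral)
  also have "\<dots> = (\<Sum>a\<in>Z. \<Sum>b\<in>Z. d a * cnj (d b) * pick_entry J i a b)"
  proof (intro sum.cong refl)
    fix a b assume *: "a \<in> Z" "b \<in> Z"
    then have "a \<in> points J" "b \<in> points J" "a \<noteq> i" "b \<noteq> i" using Z by auto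
    have G: "gram J a b - gram J a i * gram J i b / gram J i i = gram J a b * pick_entry J i a b"
      using nzG[OF \<open>a \<in> points J\<close> \<open>b \<in> points J\<close>] by (simp add: pick_entry_def right_diff_distrib)
    have "?t a b = c a * cnj (c b) * ((1 - cnj (s a) * s b) * gram J a b) * pick_entry J i a b"
      unfolding G using * by (simp add: s')
    also have "\<dots> = (c a * \<gamma> a) * cnj (c b * \<gamma> b) * pick_entry J i a b"
      unfolding fac[OF *] by simp
    also have "\<dots> = d a * cnj (d b) * pick_entry J i a b"
      using * nz \<open>a \<noteq> i\<close> \<open>b \<noteq> i\<close> by (simp add: c_def)
    finally show "?t a b = d a * cnj (d b) * pick_entry J i a b" .
  qed
  finally show ?thesis .
qed

section \<open>Vanishing minors and the cocycle condition\<close>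

context fin_rkhs
begin

abbreviation "F \<equiv> pick_entry H"

lemma pick_entry_cnj: "i \<in> X \<Longrightarrow> a \<in> X \<Longrightarrow> b \<in> X \<Longrightarrow> cnj (F i a b) = F i b a"
  by (simp add: pick_entry_def gram_cnj mult.commute)

lemma delta_sq:
  assumes "i \<in> X" "a \<in> X"
  shows "(delta H i a)\<^sup>2 = 1 - (cmod (G i a))\<^sup>2 / (Re (G i i) * Re (G a a))"
    and "a \<noteq> i \<Longrightarrow> delta H i a > 0"
proof -
  have "(cmod (G i a))\<^sup>2 \<le> Re (G i i) * Re (G a a)"
  proof (cases "i = a")
    case True
    then show ?thesis using gram_self[OF assms(1)] gram_pos[OF assms(1)]
      by (metis norm_of_real abs_of_pos order_refl power2_eq_square)
  qed (use gram_strict assms in force)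
  then show "(delta H i a)\<^sup>2 = 1 - (cmod (G i a))\<^sup>2 / (Re (G i i) * Re (G a a))"
    using assms gram_pos unfolding delta_def by simp
  show "delta H i a > 0" if "a \<noteq> i"
    using gram_strict[of i a] that assms gram_pos unfolding delta_def by simp
qed

lemma pick_entry_diag:
  assumes "i \<in> X" "a \<in> X"
  shows "F i a a = of_real ((delta H i a)\<^sup>2)"
proof -
  have "G a i * G i a = of_real ((cmod (G i a))\<^sup>2)"
    using assms by (simp only: complex_norm_square gram_cnj mult.commute)
  moreover have "G a a * G i i = of_real (Re (G i i) * Re (G a a))"
    using assms by (metis gram_self of_real_mult mult.commute)
  ultimately show ?thesis unfolding delta_sq(1)[OF assms] pick_entry_def by simp
qed

text \<open>\<open>LF H i a b\<close> is \<open>cmod (F i a b) / delta H i a\<close>, and the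
  diagonal of \<open>F i\<close> consists of squares of \<open>delta\<close>; clearing the
  denominator and squaring leaves a 2 by 2 minor.\<close>

lemma LF_eq_delta_iff:
  assumes "i \<in> X" "a \<in> X" "b \<in> X" "a \<noteq> i"
  shows "LF H i a b = delta H i b \<longleftrightarrow> F i a b * F i b a = F i a a * F i b b"
proof -
  let ?p = "delta H i a" and ?q = "delta H i b"
  have p: "?p > 0" using assms delta_sq by blast
  have q: "?q \<ge> 0"
    by (cases "b = i") (use assms delta_sq(2)[of i b] gram_self[of i] gram_pos[of i] in \<open>auto simp: delta_def\<close>,
      metis abs_of_pos cancel_comm_monoid_add_class.diff_cancel divide_self_if mult_eq_0_iff norm_of_real
      order_less_irrefl order_refl power2_eq_square)
  have "F i a b * F i b a = of_real ((cmod (F i a b))\<^sup>2)"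
    using assms by (simp only: complex_norm_square pick_entry_cnj)
  then have "F i a b * F i b a = F i a a * F i b b \<longleftrightarrow> (cmod (F i a b))\<^sup>2 = (?p * ?q)\<^sup>2"
    using assms by (simp only: pick_entry_diag of_real_mult[symmetric] of_real_eq_iff power_mult_distrib)
  also have "\<dots> \<longleftrightarrow> cmod (F i a b) = ?p * ?q"
    using p q by (simp add: power2_eq_iff_nonneg)
  also have "\<dots> \<longleftrightarrow> LF H i a b = ?q"
  proof -
    have "LF H i a b = cmod (F i a b) / ?p"
      unfolding LF_def pick_entry_def using p by (simp add: real_sqrt_divide)
    then show ?thesis using p by (auto simp: field_simps)
  qed
  finally show ?thesis by blast
qed

lemma pick_entry_base [simp]:
  assumes "i \<in> X" "\<And>x y. x \<in> X \<Longrightarrow> y \<in> X \<Longrightarrow> G x y \<noteq> 0" "a \<in> X"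
  shows "F i i a = 0" "F i a i = 0"
  using assms by (simp_all add: pick_entry_def)

text \<open>A positive rank one matrix is recovered from a single row, here row \<open>j\<close>
  divided by the root of its diagonal entry. For \<open>a = i\<close> the entry to cancel is zero,
  but so is the whole row.\<close>

lemma pick_entry_factor:
  assumes X: "i \<in> X" "j \<in> X" "a \<in> X" "b \<in> X" and "j \<noteq> i"
    and nzG: "\<And>x y. x \<in> X \<Longrightarrow> y \<in> X \<Longrightarrow> G x y \<noteq> 0"
    and rank: "F i j a * F i a j = F i j j * F i a a"
    and cocycle: "F i j a * F i a b = F i a a * F i j b"
  shows "cnj (F i j a / of_real (delta H i j)) * (F i j b / of_real (delta H i j)) = F i a b"
proof -
  have dj: "delta H i j > 0" using assms delta_sq by blast
  have "cnj (F i j a / of_real (delta H i j)) * (F i j b / of_real (delta H i j)) = F i a j * F i j b / F i j j"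
    using X dj by (simp add: pick_entry_cnj pick_entry_diag power2_eq_square)
  also have "\<dots> = F i a b"
  proof (cases "a = i")
    case True
    then show ?thesis using X nzG by simp
  next
    case False
    then have nz: "F i a a \<noteq> 0" "F i j j \<noteq> 0"
      using X dj delta_sq(2)[of i a] by (auto simp: pick_entry_diag)
    have "F i a a * (F i a j * F i j b) = F i a j * (F i j a * F i a b)"
      unfolding cocycle by (simp add: mult_ac)
    also have "\<dots> = F i a a * (F i j j * F i a b)"
      using rank by (metis mult.assoc mult.commute)
    finally show ?thesis using nz by (simp add: field_simps)
  qed
  finally show ?thesis .
qed

text \<open>The three minors of \<open>F i\<close> fix the modulus of the triple product, so only
  its argument is open. The minor of \<open>F j\<close> serves to build a multiplier, and the
  positivity it yields for \<open>F i\<close> settles the argument.\<close>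

lemma pick_entry_cocycle:
  assumes X: "i \<in> X" "j \<in> X" "p \<in> X" "q \<in> X" and dist: "distinct [i, j, p, q]"
    and nzG: "\<And>x y. x \<in> X \<Longrightarrow> y \<in> X \<Longrightarrow> G x y \<noteq> 0"
    and Pick: "complete_Pick (sub_rkhs H {i, j, p, q})"
    and jpq: "F j p q * F j q p = F j p p * F j q q"
    and ijp: "F i j p * F i p j = F i j j * F i p p"
    and ijq: "F i j q * F i q j = F i j j * F i q q"
    and ipq: "F i p q * F i q p = F i p p * F i q q"
  shows "F i j p * F i p q * F i q j = F i j j * F i p p * F i q q"
proof -
  let ?Z = "{j, p, q}"
  let ?J = "sub_rkhs H {i, j, p, q}"
  have J: "fin_rkhs ?J" using X by (intro sub_rkhs) auto
  define s where "s a = F j p a / of_real (delta H j p)" for a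
  define \<gamma> where "\<gamma> a = G a j / of_real (sqrt (Re (G j j)))" for a
  \<comment> \<open>Row and column \<open>j\<close> of \<open>F j\<close> vanish, so on these three
    points the hypotheses of \<open>pick_entry_factor\<close> reduce to the single minor
    \<open>jpq\<close>.\<close>
  have s: "cnj (s a) * s b = F j a b" if "a \<in> ?Z" "b \<in> ?Z" for a b
    unfolding s_def
    by (rule pick_entry_factor) (use that X nzG dist jpq in \<open>auto simp: mult_ac\<close>)
  have rj: "Re (G j j) > 0" "G j j = of_real (Re (G j j))" using gram_pos gram_self X by auto
  have sq: "complex_of_real (sqrt (Re (G j j))) * of_real (sqrt (Re (G j j))) = G j j"
    using rj by (metis abs_of_pos of_real_mult real_sqrt_mult_self)
  \<comment> \<open>Multiplying \<open>1 - F j a b\<close> by \<open>G a b\<close> leaves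
    \<open>G a j * G j b / G j j\<close>, whose factor is the normalised Gram column
    \<open>\<gamma>\<close>.\<close>
  have fac: "(1 - cnj (s a) * s b) * gram ?J a b = \<gamma> a * cnj (\<gamma> b)" if "a \<in> ?Z" "b \<in> ?Z" for a b
  proof -
    have ab: "a \<in> X" "b \<in> X" using that X by auto
    have "\<gamma> a * cnj (\<gamma> b) = G a j * G j b / G j j"
      using ab X sq by (simp add: \<gamma>_def gram_cnj)
    then show ?thesis
      unfolding s[OF that] using nzG[OF ab] by (simp add: pick_entry_def)
  qed
  define f where "f a = (delta H i a)\<^sup>2" for a
  have f: "F i a a = of_real (f a)" if "a \<in> ?Z" for a
    unfolding f_def using that X by (intro pick_entry_diag) auto
  have fpos: "f a > 0" if "a \<in> ?Z" for a
    unfolding f_def using that X dist delta_sq(2)[of i a] by auto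
  \<comment> \<open>With this test vector the form is \<open>2 Re T - 2 F i j j\<close>, while \<open>\<bar>T\<bar> = F i j j\<close>; so \<open>T = F i j j\<close>.\<close>
  define d where "d a = (if a = j then -2 else F i j a / F i a a)" for a
  define T where "T = F i j p * F i p q * F i q j / (F i p p * F i q q)"
  have psd: "0 \<le> Re (\<Sum>a\<in>?Z. \<Sum>b\<in>?Z. d a * cnj (d b) * pick_entry ?J i a b)"
    by (rule pick_entry_psd[OF J Pick, where s = s and \<gamma> = \<gamma> and a\<^sub>0 = j and b\<^sub>0 = p])
      (use fac X dist nzG rj in \<open>auto simp: \<gamma>_def\<close>)
  have nz: "F i p p \<noteq> 0" "F i q q \<noteq> 0" using fpos f by force+
  have d: "d j = -2" "d p = F i j p / F i p p" "d q = F i j q / F i q q"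
    "cnj (d j) = -2" "cnj (d p) = F i p j / F i p p" "cnj (d q) = F i q j / F i q q"
    using X dist by (auto simp: d_def pick_entry_cnj)
  have sum: "(\<Sum>a\<in>?Z. \<Sum>b\<in>?Z. d a * cnj (d b) * F i a b) = T + cnj T - 2 * F i j j"
  proof -
    have cT: "cnj T = F i p j * F i q p * F i j q / (F i p p * F i q q)"
      using X by (simp add: T_def pick_entry_cnj)
    have jj: "F i j j = F i j p * F i p j / F i p p" "F i j j = F i j q * F i q j / F i q q"
      using ijp ijq nz by simp_all
    have "(\<Sum>a\<in>?Z. \<Sum>b\<in>?Z. d a * cnj (d b) * F i a b) =
        d j * cnj (d j) * F i j j + d j * cnj (d p) * F i j p + d j * cnj (d q) * F i j q +
        (d p * cnj (d j) * F i p j + d p * cnj (d p) * F i p p + d p * cnj (d q) * F i p q) +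
        (d q * cnj (d j) * F i q j + d q * cnj (d p) * F i q p + d q * cnj (d q) * F i q q)"
      using dist by (simp add: add_ac)
    moreover have "d j * cnj (d j) * F i j j = 4 * F i j j" by (simp add: d)
    moreover have "d j * cnj (d p) * F i j p = -2 * F i j j" "d p * cnj (d j) * F i p j = -2 * F i j j"
       "d p * cnj (d p) * F i p p = F i j j"
      unfolding d(4-6) unfolding d(1-3) jj(1) using nz by (simp_all add: mult_ac)
    moreover have "d j * cnj (d q) * F i j q = -2 * F i j j" "d q * cnj (d j) * F i q j = -2 * F i j j"
       "d q * cnj (d q) * F i q q = F i j j"
      unfolding d(4-6) unfolding d(1-3) jj(2) using nz by (simp_all add: mult_ac)
    moreover have "d p * cnj (d q) * F i p q = T"
      unfolding d(4-6) unfolding d(1-3) T_def by simp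
    moreover have "d q * cnj (d p) * F i q p = cnj T"
      unfolding d(4-6) unfolding d(1-3) cT by (simp add: mult_ac)
    ultimately show ?thesis by simp
  qed
  have ReT: "Re T \<ge> f j"
    using psd unfolding pick_entry_sub_rkhs sum by (simp add: f)
  \<comment> \<open>Each minor turns one conjugate pair into a product of diagonal entries;
    everything but the square of \<open>F i j j\<close> cancels.\<close>
  have "T * cnj T = (F i j p * F i p j) * (F i p q * F i q p) * (F i j q * F i q j) / (F i p p * F i q q)\<^sup>2"
    using X by (simp add: T_def pick_entry_cnj power2_eq_square mult_ac)
  also have "\<dots> = (F i j j)\<^sup>2" unfolding ijp ipq ijq using nz by (simp add: field_simps power2_eq_square)
  also have "\<dots> = of_real ((f j)\<^sup>2)" by (simp add: f)
  finally have "(cmod T)\<^sup>2 = (f j)\<^sup>2"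
    unfolding complex_norm_square[symmetric] of_real_eq_iff .
  then have "(Re T)\<^sup>2 + (Im T)\<^sup>2 = (f j)\<^sup>2" by (simp add: cmod_power2)
  moreover have "(f j)\<^sup>2 \<le> (Re T)\<^sup>2" using ReT fpos[of j] by (intro power_mono) auto
  ultimately have "(Im T)\<^sup>2 \<le> 0" "(Re T)\<^sup>2 = (f j)\<^sup>2" using zero_le_power2[of "Im T"] by linarith+
  then have "T = of_real (f j)"
    using ReT fpos[of j] by (simp add: complex_eq_iff power2_eq_iff_nonneg)
  then show ?thesis
    using nz f[of j] by (simp add: T_def field_simps)
qed

end

section \<open>The Hardy space: Gram entries and the rank one form of \<open>F\<close>\<close>

lemma hardy_kernel_expansion:
  assumes "u \<in> ball 0 1"
  shows "fps_expansion (hardy_kernel u) 0 = Abs_fps (\<lambda>n. cnj u ^ n)"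
proof (intro fps_expansion_eqI has_fps_expansionI)
  show "\<forall>\<^sub>F w in nhds 0. (\<lambda>n. fps_nth (Abs_fps (\<lambda>n. cnj u ^ n)) n * w ^ n) sums hardy_kernel u w"
  proof (rule eventually_nhds_in_open[of "ball 0 1", THEN eventually_mono])
    fix w :: complex assume w: "w \<in> ball 0 1"
    have "cmod u * cmod w < 1"
      using assms w mult_strict_mono'[of "cmod u" 1 "cmod w" 1] by simp
    then show "(\<lambda>n. fps_nth (Abs_fps (\<lambda>n. cnj u ^ n)) n * w ^ n) sums hardy_kernel u w"
      using geometric_sums[of "cnj u * w"] w
      by (simp add: hardy_kernel_def power_mult_distrib norm_mult)
  qed simp_all
qed

text \<open>The Taylor coefficients \<open>cnj u ^ n\<close> and \<open>cnj v ^ n\<close> pair to a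
  second geometric series.\<close>

lemma gram_DA1:
  assumes "u \<in> ball 0 1" "v \<in> ball 0 1"
  shows "gram (DA1 Y) u v = 1 / (1 - cnj u * v)"
proof -
  have "cmod u * cmod v < 1"
    using assms mult_strict_mono'[of "cmod u" 1 "cmod v" 1] by simp
  then have "(\<lambda>n. (cnj u * v) ^ n) sums (1 / (1 - cnj u * v))"
    by (intro geometric_sums) (simp add: norm_mult)
  then show ?thesis
    using assms
    by (simp add: gram_def DA1_def hardy_inprod_def hardy_kernel_expansion power_mult_distrib sums_iff)
qed

text \<open>In the quotient \<open>\<gamma> a\<close>, \<open>cnj (\<gamma> b)\<close>,
  \<open>\<gamma> i\<close> and \<open>cnj (\<gamma> i)\<close> each occur once above and once
  below.\<close>

lemma pick_entry_rescaled:
  assumes "\<And>x y. x \<in> S \<Longrightarrow> y \<in> S \<Longrightarrow> gram H' (\<Xi> x) (\<Xi> y) = \<gamma> x * cnj (\<gamma> y) * gram H x y"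
    and "i \<in> S" "a \<in> S" "b \<in> S" "\<gamma> i \<noteq> 0" "\<gamma> a \<noteq> 0" "\<gamma> b \<noteq> 0"
  shows "pick_entry H' (\<Xi> i) (\<Xi> a) (\<Xi> b) = pick_entry H i a b"
  using assms(2-) by (simp add: pick_entry_def assms(1))

text \<open>Here \<open>v\<close> is the disk automorphism moving \<open>i\<close> to \<open>0\<close>.\<close>

lemma pick_entry_DA1:
  assumes "i \<in> ball 0 1" "a \<in> ball 0 1" "b \<in> ball 0 1"
  defines "v \<equiv> \<lambda>a. (a - i) / (1 - cnj i * a)"
  shows "pick_entry (DA1 Y) i a b = cnj (v a) * v b"
proof -
  have nz: "1 - cnj x * y \<noteq> 0" if "x \<in> ball 0 1" "y \<in> ball 0 1" for x y :: complex
  proof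
    assume "1 - cnj x * y = 0"
    then have "cmod x * cmod y = 1" by (metis complex_mod_cnj eq_iff_diff_eq_0 norm_mult norm_one)
    moreover have "cmod x * cmod y < 1"
      using that mult_strict_mono'[of "cmod x" 1 "cmod y" 1] by simp
    ultimately show False by simp
  qed
  have n: "1 - cnj a * i \<noteq> 0" "1 - cnj i * b \<noteq> 0" "1 - cnj a * b \<noteq> 0" "1 - cnj i * i \<noteq> 0"
    using nz assms by blast+
  have "pick_entry (DA1 Y) i a b = 1 - (1 - cnj a * b) * (1 - cnj i * i) / ((1 - cnj a * i) * (1 - cnj i * b))"
    using assms by (simp add: pick_entry_def gram_DA1 mult.commute)
  also have "\<dots> = ((1 - cnj a * i) * (1 - cnj i * b) - (1 - cnj a * b) * (1 - cnj i * i)) /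
      ((1 - cnj a * i) * (1 - cnj i * b))"
    using n by (simp add: diff_divide_distrib)
  also have "(1 - cnj a * i) * (1 - cnj i * b) - (1 - cnj a * b) * (1 - cnj i * i) =
      (cnj a - cnj i) * (b - i)"
    by (simp add: algebra_simps)
  also have "\<dots> / ((1 - cnj a * i) * (1 - cnj i * b)) = cnj (v a) * v b"
    by (simp add: v_def mult.commute)
  finally show ?thesis .
qed

text \<open>Solving the definition of \<open>F i\<close> for the Gram matrix gives
  \<open>G a b = G a i * G i b / (G i i * (1 - F i a b))\<close>: up to a rescaling, the Hardy
  kernel at the points \<open>s a\<close>.\<close>

lemma (in fin_rkhs) rescaling_DA1I:
  assumes nzG: "\<And>x y. x \<in> X \<Longrightarrow> y \<in> X \<Longrightarrow> G x y \<noteq> 0"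
    and i: "i \<in> X" and s: "\<And>a b. a \<in> X \<Longrightarrow> b \<in> X \<Longrightarrow> cnj (s a) * s b = F i a b"
  shows "\<exists>Y. finite Y \<and> Y \<subseteq> ball 0 1 \<and> H \<sim>\<^sub>r DA1 Y"
proof (intro exI conjI)
  \<comment> \<open>With this factor \<open>\<gamma> a * cnj (\<gamma> i) * G a i\<close> is 1, in
    agreement with \<open>s i = 0\<close>.\<close>
  define \<gamma> where "\<gamma> a = of_real (sqrt (Re (G i i))) / G a i" for a
  have ii: "complex_of_real (sqrt (Re (G i i))) * of_real (sqrt (Re (G i i))) = G i i"
    using gram_pos[OF i] gram_self[OF i] by (metis less_imp_le of_real_mult real_sqrt_mult_self abs_of_pos)
  have \<gamma>nz: "\<gamma> a \<noteq> 0" if "a \<in> X" for a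
    using that i gram_pos[OF i] nzG by (simp add: \<gamma>_def)
  have ball: "s a \<in> ball 0 1" if a: "a \<in> X" for a
  proof -
    have "complex_of_real ((cmod (s a))\<^sup>2) = of_real ((delta H i a)\<^sup>2)"
      using s[OF a a] pick_entry_diag[OF i a] by (simp only: complex_norm_square mult.commute)
    then have "(cmod (s a))\<^sup>2 = (delta H i a)\<^sup>2" by (simp only: of_real_eq_iff)
    \<comment> \<open>The nonvanishing of \<open>G i a\<close> keeps the point strictly inside the
      disk.\<close>
    also have "\<dots> < 1\<^sup>2"
      using delta_sq(1)[OF i a] nzG[OF i a] gram_pos[OF i] gram_pos[OF a] by simp
    finally have "cmod (s a) < 1" by (rule power2_less_imp_less) simp
    then show ?thesis by simp
  qed
  have gr: "gram (DA1 (s ` X)) (s a) (s b) = \<gamma> a * cnj (\<gamma> b) * G a b" if ab: "a \<in> X" "b \<in> X" for a b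
  proof -
    have "gram (DA1 (s ` X)) (s a) (s b) = 1 / (1 - F i a b)"
      using ball ab by (simp add: gram_DA1 s)
    also have "\<dots> = G i i / (G a i * G i b) * G a b" by (simp add: pick_entry_def)
    also have "\<dots> = \<gamma> a * cnj (\<gamma> b) * G a b"
      unfolding \<gamma>_def using i ab ii by (simp add: gram_cnj)
    finally show ?thesis .
  qed
  \<comment> \<open>Two indices sharing a point would give equality in Cauchy-Schwarz for their
    kernels, against \<open>gram_strict\<close>.\<close>
  have inj: "inj_on s X"
  proof (rule inj_onI, rule ccontr)
    fix a b assume ab: "a \<in> X" "b \<in> X" "s a = s b" "a \<noteq> b"
    have "\<gamma> a * cnj (\<gamma> b) * G a b = \<gamma> b * cnj (\<gamma> b) * G b b"
      "\<gamma> b * cnj (\<gamma> a) * G b a = \<gamma> a * cnj (\<gamma> a) * G a a"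
      by (metis gr ab(1-3))+
    then have *: "\<gamma> a * G a b = \<gamma> b * G b b" "\<gamma> b * G b a = \<gamma> a * G a a"
      using \<gamma>nz ab by simp_all
    have "(\<gamma> a * \<gamma> b) * (G a b * G b a) = (\<gamma> a * G a b) * (\<gamma> b * G b a)" by (simp add: mult_ac)
    also have "\<dots> = (\<gamma> a * \<gamma> b) * (G a a * G b b)" unfolding * by (simp add: mult_ac)
    finally have "G a b * G b a = G a a * G b b" using \<gamma>nz ab by simp
    then have "G a b * cnj (G a b) = G a a * G b b" using ab by (simp add: gram_cnj)
    also have "\<dots> = of_real (Re (G a a) * Re (G b b))" using gram_self ab by simp
    finally have "(cmod (G a b))\<^sup>2 = Re (G a a) * Re (G b b)"
      unfolding complex_norm_square[symmetric] of_real_eq_iff .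
    then show False using gram_strict[of a b] ab by simp
  qed
  show "finite (s ` X)" using finX by simp
  show "s ` X \<subseteq> ball 0 1" using ball by auto
  have "bij_betw s X (points (DA1 (s ` X)))" using inj by (simp add: DA1_def bij_betw_def)
  then show "H \<sim>\<^sub>r DA1 (s ` X)"
    unfolding rescaling_def using \<gamma>nz gr by (intro exI[of _ s] exI[of _ \<gamma>]) simp
qed

section \<open>Realisation in the disk versus vanishing minors for ordered indices\<close>

theorem proposition33:
  fixes H :: "('v::ab_group_add, 'x) rkhs" and x :: "nat \<Rightarrow> 'x" and m :: nat
  assumes "finite_rkhs H"
    and "bij_betw x {1..m} (points H)"
    and "m \<ge> 4"
    and "\<forall>i\<in>{1..m}. \<forall>j\<in>{1..m}. gram H (x i) (x j) \<noteq> 0"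
    and "\<forall>\<Lambda>\<subseteq>{1..m}. card \<Lambda> = 4 \<longrightarrow> complete_Pick (sub_rkhs H (x ` \<Lambda>))"
  shows "(\<exists>Y. finite Y \<and> Y \<subseteq> ball 0 1 \<and> H \<sim>\<^sub>r DA1 Y) \<longleftrightarrow>
         (\<forall>i j k. 1 \<le> i \<and> i < j \<and> j < k \<and> k \<le> m \<longrightarrow>
            LF H (x i) (x j) (x k) = delta H (x i) (x k))"
proof -
  interpret fin_rkhs H by unfold_locales (rule assms)
  have xX: "x i \<in> X" if "1 \<le> i" "i \<le> m" for i using that assms(2) by (auto simp: bij_betw_def)
  have xinj: "x i = x j \<longleftrightarrow> i = j" if "1 \<le> i" "i \<le> m" "1 \<le> j" "j \<le> m" for i j
    using that assms(2) by (auto simp: bij_betw_def inj_on_eq_iff)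
  have XE: "\<exists>n. 1 \<le> n \<and> n \<le> m \<and> a = x n" if "a \<in> X" for a
    using that assms(2) by (force simp: bij_betw_def)
  have nzG: "G a b \<noteq> 0" if "a \<in> X" "b \<in> X" for a b
    using XE[OF that(1)] XE[OF that(2)] assms(4) by auto
  have LF: "LF H (x i) (x j) (x k) = delta H (x i) (x k) \<longleftrightarrow>
      F (x i) (x j) (x k) * F (x i) (x k) (x j) = F (x i) (x j) (x j) * F (x i) (x k) (x k)"
    if "1 \<le> i" "i < j" "j < k" "k \<le> m" for i j k
    using that by (intro LF_eq_delta_iff) (simp_all add: xX xinj)
  show ?thesis
  proof (intro iffI allI impI)
    fix i j k
    assume "\<exists>Y. finite Y \<and> Y \<subseteq> ball 0 1 \<and> H \<sim>\<^sub>r DA1 Y" and ijk: "1 \<le> i \<and> i < j \<and> j < k \<and> k \<le> m"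
    then obtain Y \<Xi> \<gamma> where Y: "Y \<subseteq> ball 0 1" "bij_betw \<Xi> X (points (DA1 Y))"
      and \<gamma>: "\<And>a. a \<in> X \<Longrightarrow> \<gamma> a \<noteq> 0"
      and gr: "\<And>a b. a \<in> X \<Longrightarrow> b \<in> X \<Longrightarrow> gram (DA1 Y) (\<Xi> a) (\<Xi> b) = \<gamma> a * cnj (\<gamma> b) * G a b"
      unfolding rescaling_def by blast
    have ball: "\<Xi> a \<in> ball 0 1" if "a \<in> X" for a
      using that Y by (auto simp: DA1_def bij_betw_def)
    \<comment> \<open>A rank one factorisation with base point \<open>x i\<close>; every 2 by 2
      minor of such a matrix vanishes.\<close>
    obtain v where v: "\<And>a b. a \<in> X \<Longrightarrow> b \<in> X \<Longrightarrow> F (x i) a b = cnj (v a) * v b"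
    proof
      fix a b assume ab: "a \<in> X" "b \<in> X"
      have i: "x i \<in> X" using ijk xX by auto
      have "F (x i) a b = pick_entry (DA1 Y) (\<Xi> (x i)) (\<Xi> a) (\<Xi> b)"
        using pick_entry_rescaled[of X "DA1 Y" \<Xi> \<gamma> H "x i" a b] gr i ab \<gamma> by simp
      then show "F (x i) a b = cnj ((\<Xi> a - \<Xi> (x i)) / (1 - cnj (\<Xi> (x i)) * \<Xi> a)) *
          ((\<Xi> b - \<Xi> (x i)) / (1 - cnj (\<Xi> (x i)) * \<Xi> b))"
        using pick_entry_DA1 ball i ab by simp
    qed
    then show "LF H (x i) (x j) (x k) = delta H (x i) (x k)"
      using ijk by (subst LF) (simp_all add: xX v)
  next
    assume eq: "\<forall>i j k. 1 \<le> i \<and> i < j \<and> j < k \<and> k \<le> m \<longrightarrow> LF H (x i) (x j) (x k) = delta H (x i) (x k)"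
    define f where "f n p q = F (x n) (x p) (x q)" for n p q
    have rank: "f i j k * f i k j = f i j j * f i k k" if "1 \<le> i" "i < j" "j < k" "k \<le> m" for i j k
      using eq LF that unfolding f_def by blast
    \<comment> \<open>Fixing the first two indices as 1 and 2 makes all minors involved, those of
      \<open>f 1\<close> on pairs from 2, \<open>p\<close>, \<open>q\<close> and that of
      \<open>f 2\<close> on \<open>p\<close>, \<open>q\<close>, have increasing indices, as
      \<open>rank\<close> demands.\<close>
    have cocycle: "f 1 2 p * f 1 p q * f 1 q 2 = f 1 2 2 * f 1 p p * f 1 q q"
      if pq: "2 < p" "p < q" "q \<le> m" for p q
      unfolding f_def
    proof (rule pick_entry_cocycle)
      have "complete_Pick (sub_rkhs H (x ` {1, 2, p, q}))"
        using assms(5)[rule_format, of "{1, 2, p, q}"] pq by simp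
      then show "complete_Pick (sub_rkhs H {x 1, x 2, x p, x q})" by simp
      show "distinct [x 1, x 2, x p, x q]" using pq by (simp add: xinj)
    qed (use pq rank[of 2 p q] rank[of 1 2 p] rank[of 1 2 q] rank[of 1 p q] nzG in \<open>simp_all add: f_def xX\<close>)
    have cnj: "cnj (f 1 p q) = f 1 q p" if "1 \<le> p" "p \<le> m" "1 \<le> q" "q \<le> m" for p q
      unfolding f_def using that assms(3) by (intro pick_entry_cnj xX) auto
    have zero: "f 1 1 p = 0" "f 1 p 1 = 0" if "1 \<le> p" "p \<le> m" for p
      unfolding f_def using that assms(3) nzG by (auto intro!: pick_entry_base xX)
    have rank2: "f 1 2 p * f 1 p 2 = f 1 2 2 * f 1 p p" if "1 \<le> p" "p \<le> m" for p
    proof -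
      consider "p = 1" | "p = 2" | "2 < p" using \<open>1 \<le> p\<close> by linarith
      then show ?thesis using rank[of 1 2 p] that zero[of 1] zero[of 2] assms(3) by cases (auto simp: zero)
    qed
    \<comment> \<open>Conjugation exchanges \<open>p\<close> and \<open>q\<close>, which removes the
      order restriction.\<close>
    have cocycle': "f 1 2 p * f 1 p q * f 1 q 2 = f 1 2 2 * f 1 p p * f 1 q q"
      if pq: "2 < p" "2 < q" "p \<noteq> q" "p \<le> m" "q \<le> m" for p q
    proof (cases "p < q")
      case False
      have "cnj (f 1 2 q * f 1 q p * f 1 p 2) = cnj (f 1 2 2 * f 1 q q * f 1 p p)"
        using cocycle[of q p] False pq by simp
      then show ?thesis using pq by (simp add: cnj mult_ac del: One_nat_def)
    qed (use cocycle pq in blast)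
    have nz: "f 1 p p \<noteq> 0" if "2 \<le> p" "p \<le> m" for p
    proof -
      have *: "x 1 \<in> X" "x p \<in> X" "x p \<noteq> x 1" using that by (simp_all add: xX xinj)
      show ?thesis unfolding f_def pick_entry_diag[OF *(1,2)] using delta_sq(2)[OF *] by simp
    qed
    \<comment> \<open>The cocycle hypothesis of \<open>pick_entry_factor\<close> for base 1 and row
      2. The Pick property enters through the case of distinct \<open>p\<close>, \<open>q\<close>
      beyond 2.\<close>
    have main: "f 1 2 p * f 1 p q = f 1 p p * f 1 2 q" if pq: "1 \<le> p" "p \<le> m" "1 \<le> q" "q \<le> m" for p q
    proof -
      consider "p = 1" | "p = 2" | "p = q" | "q = 1" | "q = 2" | "2 < p" "2 < q" "p \<noteq> q"
        using pq by linarith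
      then show ?thesis
      proof cases
        case 5
        then show ?thesis using rank2[of p] pq by (simp add: mult.commute)
      next
        case 6
        \<comment> \<open>The triple identity is multiplied by \<open>f 1 2 q\<close>; the minor
          then turns \<open>f 1 q 2 * f 1 2 q\<close> into nonzero diagonal entries, which
          cancel.\<close>
        have "f 1 q 2 * f 1 2 q = f 1 2 2 * f 1 q q" using rank2[of q] pq by (simp add: mult.commute)
        then have "(f 1 2 2 * f 1 q q) * (f 1 2 p * f 1 p q) = (f 1 2 p * f 1 p q) * (f 1 q 2 * f 1 2 q)"
          by (metis mult.commute)
        also have "\<dots> = (f 1 2 p * f 1 p q * f 1 q 2) * f 1 2 q" by (simp only: mult.assoc)
        also have "\<dots> = (f 1 2 2 * f 1 p p * f 1 q q) * f 1 2 q" using cocycle'[of p q] 6 pq by simp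
        finally have "(f 1 2 2 * f 1 q q) * (f 1 2 p * f 1 p q) = (f 1 2 2 * f 1 q q) * (f 1 p p * f 1 2 q)"
          by (simp only: mult_ac)
        then show ?thesis using nz[of 2] nz[of q] 6 pq by simp
      qed (use zero pq assms(3) in \<open>simp_all add: mult.commute\<close>)
    qed
    show "\<exists>Y. finite Y \<and> Y \<subseteq> ball 0 1 \<and> H \<sim>\<^sub>r DA1 Y"
    \<comment> \<open>The points of the disk are the entries of row \<open>x 2\<close> of
      \<open>F (x 1)\<close>, divided by \<open>delta H (x 1) (x 2)\<close>.\<close>
    proof (rule rescaling_DA1I[OF nzG])
      show "x 1 \<in> X" using assms(3) by (intro xX) auto
      fix a b assume "a \<in> X" "b \<in> X"
      then obtain p q where pq: "1 \<le> p" "p \<le> m" "a = x p" "1 \<le> q" "q \<le> m" "b = x q"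
        using XE by metis
      show "cnj (F (x 1) (x 2) a / of_real (delta H (x 1) (x 2))) *
          (F (x 1) (x 2) b / of_real (delta H (x 1) (x 2))) = F (x 1) a b"
        using pq assms(3) rank2[of p] main[of p q]
        by (intro pick_entry_factor nzG) (simp_all add: f_def xX xinj)
    qed
  qed
qed

end
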